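(* Catch leafage is not bounded by any function of leafage. If $F_n$ denotes the $n$-vertex digraph whose adjacency matrix is $$\begin{pmatrix} I & Y\\ Y^T & 1\end{pmatrix},$$ where $I$ denotes the $(n-1)\times(n-1)$ identity matrix and $Y$ denotes the column vector of $n-1$ ones, then $f^*(F_n)=l(F_n)=2$, but $l^*(F_n)=n-1$.
   Context: A digraph $D$ is finite with vertex set $V(D)$, and is identified with a relation $D\subseteq V(D)\times V(D)$ (its set of edges; loops are allowed, no multiple edges). Its adjacency matrix has entry $1$ in position $(u,v)$ if $uv$ is an edge and $0$ otherwise. $\overline{D}=(V(D)\times V(D))\setminus D$ is its complement. Trees are finite; a leaf is a vertex of degree 1. Subtrees are nonempty connected subgraphs. A subtree representation of $D$ in a host tree $T$ assigns to each vertex $v$ an ordered pair $(S_v,T_v)$ of subtrees of $T$ (source subtree and sink subtree) such that $uv$ is an edge of $D$ if and only if $S_u$ and $T_v$ have a common vertex (for all $u,v\in V(D)$, including $u=v$). The leafage $l(D)$ is the minimum number of leaves of a host tree in which $D$ has a subtree representation. The catch leafage $l^*(D)$ is the minimum number of leaves of a host tree in which $D$ has a subtree representation where every sink subtree $T_v$ is a single vertex. A digraph is a Ferrers digraph if its successor sets $\{u: vu\in E\}$, over all vertices $v$, are linearly ordered by inclusion; equivalently, its adjacency matrix has no $2\times 2$ permutation submatrix (two rows and two columns, not necessarily consecutive). $f^*(D)$ is the minimum number of pairwise disjoint Ferrers digraphs on $V(D)$ (as edge sets) whose union is $\overline{D}$.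
   Formalization: The values of f*, l and l* for F_n are stated for n ≥ 3; for n = 1 and n = 2 the adjacency matrix is all ones, the complement is empty and f*(F_n) = 0, so the claim fails there. *)

theory Defs
  imports
    "Graph_Theory.Graph_Theory"
    "Jordan_Normal_Form.Matrix"
    "HOL-Library.Disjoint_Sets"
begin

text \<open>
  Digraphs are records of type \<open>'a pair_pre_digraph\<close> satisfying
  \<^const>\<open>pair_fin_digraph\<close>: a finite vertex set \<open>pverts\<close> and a relation \<open>parcs\<close> on it, loops
  allowed. Undirected simple graphs are the symmetric loopless ones
  (\<^const>\<open>pair_graph\<close>), an undirected edge being a pair of opposite arcs.
\<close>

section \<open>Host trees and subtrees\<close>

text \<open>
  The library's \<open>tree\<close> forbids directed cycles, and in a symmetric digraph a pair of opposite
  arcs already forms one, of length 2. The cycles of the undirected graph are those of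
  length at least 3.
\<close>

definition undirected_tree :: "'b pair_pre_digraph \<Rightarrow> bool" where
  "undirected_tree T \<longleftrightarrow> pair_graph T \<and> Digraph_Component.connected (with_proj T) \<and>
     \<not> (\<exists>p. pre_digraph.cycle (with_proj T) p \<and> length p \<ge> 3)"

text \<open>In a symmetric loopless digraph the out-degree is the degree of the undirected graph.\<close>

definition leaves :: "'b pair_pre_digraph \<Rightarrow> 'b set" where
  "leaves T = {v \<in> pverts T. out_degree (with_proj T) v = 1}"

text \<open>Nonemptiness is part of the library's notion of connectedness.\<close>

definition subtree :: "'b pair_pre_digraph \<Rightarrow> 'b pair_pre_digraph \<Rightarrow> bool" where
  "subtree S T \<longleftrightarrow> pair_graph S \<and> subgraph (with_proj S) (with_proj T) \<and>
     Digraph_Component.connected (with_proj S)"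


section \<open>Leafage and catch leafage\<close>

definition subtree_rep ::
  "'a pair_pre_digraph \<Rightarrow> 'b pair_pre_digraph \<Rightarrow>
   ('a \<Rightarrow> 'b pair_pre_digraph) \<Rightarrow> ('a \<Rightarrow> 'b pair_pre_digraph) \<Rightarrow> bool" where
  "subtree_rep D H S T \<longleftrightarrow> undirected_tree H \<and>
     (\<forall>v\<in>pverts D. subtree (S v) H \<and> subtree (T v) H) \<and>
     (\<forall>u\<in>pverts D. \<forall>v\<in>pverts D.
        (u, v) \<in> parcs D \<longleftrightarrow> pverts (S u) \<inter> pverts (T v) \<noteq> {})"

definition catch_tree_rep ::
  "'a pair_pre_digraph \<Rightarrow> 'b pair_pre_digraph \<Rightarrow>
   ('a \<Rightarrow> 'b pair_pre_digraph) \<Rightarrow> ('a \<Rightarrow> 'b pair_pre_digraph) \<Rightarrow> bool" where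
  "catch_tree_rep D H S T \<longleftrightarrow> subtree_rep D H S T \<and>
     (\<forall>v\<in>pverts D. \<exists>x. pverts (T v) = {x})"

text \<open>
  Host trees are finite, so taking their vertices to be natural numbers loses no generality.
\<close>

definition leafage :: "'a pair_pre_digraph \<Rightarrow> nat" where
  "leafage D = (LEAST k. \<exists>(H :: nat pair_pre_digraph) S T.
     subtree_rep D H S T \<and> card (leaves H) = k)"

definition catch_leafage :: "'a pair_pre_digraph \<Rightarrow> nat" where
  "catch_leafage D = (LEAST k. \<exists>(H :: nat pair_pre_digraph) S T.
     catch_tree_rep D H S T \<and> card (leaves H) = k)"


section \<open>Ferrers digraphs\<close>

definition ferrers_digraph :: "'a pair_pre_digraph \<Rightarrow> bool" where
  "ferrers_digraph D \<longleftrightarrow> pair_fin_digraph D \<and>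
     (\<forall>u\<in>pverts D. \<forall>v\<in>pverts D.
        parcs D `` {u} \<subseteq> parcs D `` {v} \<or> parcs D `` {v} \<subseteq> parcs D `` {u})"

definition complement_digraph :: "'a pair_pre_digraph \<Rightarrow> 'a pair_pre_digraph" where
  "complement_digraph D =
     \<lparr> pverts = pverts D, parcs = (pverts D \<times> pverts D) - parcs D \<rparr>"

text \<open>The number \<open>f\<^sup>*(D)\<close>; the Ferrers digraphs are given by their edge sets.\<close>

definition ferrers_partition_number :: "'a pair_pre_digraph \<Rightarrow> nat" where
  "ferrers_partition_number D = (LEAST k. \<exists>\<F>. finite \<F> \<and> card \<F> = k \<and>
     (\<forall>E\<in>\<F>. ferrers_digraph \<lparr> pverts = pverts D, parcs = E \<rparr>) \<and>
     disjoint \<F> \<and> \<Union>\<F> = parcs (complement_digraph D))"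


section \<open>The digraphs \<open>F\<^sub>n\<close>\<close>

text \<open>Rows and columns are indexed by \<open>0, \<dots>, n - 1\<close>.\<close>

definition adjacency_matrix :: "nat \<Rightarrow> nat pair_pre_digraph \<Rightarrow> int mat" where
  "adjacency_matrix n D = mat n n (\<lambda>(u, v). if (u, v) \<in> parcs D then 1 else 0)"

definition F_matrix :: "nat \<Rightarrow> int mat" where
  "F_matrix n =
     (let Y = mat (n - 1) 1 (\<lambda>_. 1)
      in four_block_mat (1\<^sub>m (n - 1)) Y (transpose_mat Y) (mat 1 1 (\<lambda>_. 1)))"

definition F_digraph :: "nat \<Rightarrow> nat pair_pre_digraph" where
  "F_digraph n =
     \<lparr> pverts = {..<n}, parcs = {(u, v). u < n \<and> v < n \<and> F_matrix n $$ (u, v) = 1} \<rparr>"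

lemma pair_fin_digraph_F: "pair_fin_digraph (F_digraph n)"
proof
  show "finite (parcs (F_digraph n))"
    by (rule finite_subset[of _ "{..<n} \<times> {..<n}"]) (auto simp: F_digraph_def)
qed (auto simp: F_digraph_def)

lemma adjacency_matrix_F:
  assumes "n \<ge> 1"
  shows "adjacency_matrix n (F_digraph n) = F_matrix n"
  using assms
  by (intro eq_matI) (auto simp: adjacency_matrix_def F_digraph_def F_matrix_def Let_def)

end

theory Submission
  imports Defs
begin

text \<open>
  In a catch representation of \<open>F\<^sub>n\<close>, let \<open>r\<close> be the sink vertex of the last vertex of \<open>F\<^sub>n\<close> and
  \<open>x\<^sub>i\<close> that of vertex \<open>i < n - 1\<close>. The source subtree of \<open>i\<close> contains \<open>r\<close> and \<open>x\<^sub>i\<close> but no other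
  \<open>x\<^sub>j\<close>, so no \<open>x\<^sub>j\<close> lies on the path from \<open>r\<close> to \<open>x\<^sub>i\<close>. Prolonging these \<open>n - 1\<close> paths to
  leaves therefore gives \<open>n - 1\<close> different leaves. A star attains this bound. With sink subtrees
  of arbitrary size a path on \<open>n - 1\<close> vertices suffices, the last vertex of \<open>F\<^sub>n\<close> being assigned the
  whole path.
\<close>

section \<open>Paths in undirected trees\<close>

lemma (in pair_wf_digraph) last_in_awalk_verts: "awalk u p v \<Longrightarrow> v \<in> set (pawalk_verts u p)"
  by (metis awalkE awalk_verts_non_Nil last_in_set)

text \<open>Undirected forests: running an edge forth and back is already a directed cycle of length
  2, so only longer cycles are excluded. Connectedness is assumed separately where it is
  used.\<close>

locale pair_acyclic_graph = pair_graph +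
  assumes no_long_cycle: "cycle p \<Longrightarrow> length p < 3"
begin

text \<open>Induction along the first path. If the two paths leave \<open>u\<close> by different
  arcs, following the first until it meets the second and returning along the second closes a cycle
  through \<open>u\<close>, which must have length at least 3.\<close>

lemma apath_unique:
  assumes "apath u p v" "apath u q v"
  shows "p = q"
  using assms
proof (induction p arbitrary: u q)
  case Nil
  then show ?case using apath_nonempty_ends by (auto simp: apath_Nil_iff)
next
  case (Cons e p)
  have "u \<noteq> v" using apath_nonempty_ends[OF Cons.prems(1)] by simp
  then have "q \<noteq> []" using Cons.prems(2) by (auto simp: apath_Nil_iff)
  then obtain f q' where q: "q = f # q'" by (cases q) auto
  obtain a where e: "e = (u, a)" using Cons.prems(1) by (cases e) (auto simp: apath_Cons_iff)
  obtain b where f: "f = (u, b)" using Cons.prems(2) q by (cases f) (auto simp: apath_Cons_iff)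
  have p: "(u, a) \<in> parcs G" "apath a p v" "u \<notin> set (pawalk_verts a p)"
    using Cons.prems(1) e by (auto simp: apath_Cons_iff)
  have q': "(u, b) \<in> parcs G" "apath b q' v" "u \<notin> set (pawalk_verts b q')"
    using Cons.prems(2) f q by (auto simp: apath_Cons_iff)
  show ?case
  proof (cases "a = b")
    case True
    then show ?thesis using Cons.IH[OF p(2)] q'(2) e f q by simp
  next
    case False
    have pw: "awalk a p v" and qw: "awalk b q' v" using p(2) q'(2) by (auto simp: apath_def)
    have "v \<in> set (pawalk_verts a p)" "v \<in> set (pawalk_verts b q')"
      using pw qw by (simp_all add: last_in_awalk_verts)
    \<comment> \<open>\<open>w\<close> is the first vertex of \<open>p\<close> lying on
      \<open>q'\<close>; the vertices \<open>xs\<close> before it avoid \<open>q'\<close>, which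
      keeps the cycle below free of repetitions.\<close>
    then obtain xs w ys where split: "pawalk_verts a p = xs @ w # ys"
        "w \<in> set (pawalk_verts b q')" "\<forall>x\<in>set xs. x \<notin> set (pawalk_verts b q')"
      using split_list_first_prop[of "pawalk_verts a p" "\<lambda>x. x \<in> set (pawalk_verts b q')"]
      by blast
    have "pcas a p v" using pw by (simp add: awalk_def)
    then obtain p1 p2 where p1: "pcas a p1 w" "pcas w p2 v" "p = p1 @ p2"
        "pawalk_verts a p1 = xs @ [w]"
      using awalk_decomp_verts[of a p v xs w ys] split(1) by metis
    have p1w: "awalk a p1 w" using pw p1 by (auto simp: awalk_def)
    obtain q1 q2 where q1: "q' = q1 @ q2" "awalk b q1 w" "awalk w q2 v"
      using awalk_decomp[OF qw split(2)] by blast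
    have q1v: "set (pawalk_verts b q1) \<subseteq> set (pawalk_verts b q')"
      using qw q1 by (auto simp: awalk_verts_append)
    have q1d: "distinct (pawalk_verts b q1)"
      using q'(2) awalk_verts_append[of b q1 q2 v] qw q1(1) by (auto simp: apath_def)
    have q1r: "awalk w (rev_path q1) b" using q1(2) by simp
    have rv: "pawalk_verts w (rev_path q1) = rev (pawalk_verts b q1)"
      using awalk_verts_rev_path[OF q1(2)] .
    then obtain zs where zs: "rev (pawalk_verts b q1) = w # zs"
      using awhd_of_awalk[OF q1r] awalk_verts_non_Nil[of w "rev_path q1"]
      by (metis list.collapse)
    \<comment> \<open>From \<open>u\<close> via \<open>a\<close> to \<open>w\<close>, then backwards
      along \<open>q1\<close> to \<open>b\<close> and home. Its length is 2 plus the lengths of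
      \<open>p1\<close> and \<open>q1\<close>, so the bound forces both to be empty, whence
      \<open>a = w = b\<close>.\<close>
    define c where "c = (u, a) # p1 @ rev_path q1 @ [(b, u)]"
    have bu: "(b, u) \<in> parcs G" using q'(1) arcs_symmetric by blast
    have u: "u \<in> pverts G" using bu by (rule in_arcsD2)
    have w1: "awalk w (rev_path q1 @ [(b, u)]) u"
      by (rule awalk_appendI[OF q1r]) (use bu u in \<open>auto simp: awalk_simps\<close>)
    have w2: "awalk a (p1 @ rev_path q1 @ [(b, u)]) u"
      by (rule awalk_appendI[OF p1w w1])
    have cw: "awalk u c u" using w2 p(1) by (auto simp: c_def awalk_Cons_iff)
    have "pawalk_verts w (rev_path q1 @ [(b, u)]) = w # zs @ [u]"
      using awalk_verts_append[OF w1] rv zs by simp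
    then have "pawalk_verts a (p1 @ rev_path q1 @ [(b, u)]) = xs @ w # zs @ [u]"
      using awalk_verts_append[OF w2] p1w p1(4) by simp
    then have tl: "tl (pawalk_verts u c) = xs @ w # zs @ [u]" by (simp add: c_def)
    have "set (w # zs) = set (pawalk_verts b q1)" using zs by (metis set_rev)
    moreover have "distinct (w # zs)" using zs q1d by (metis distinct_rev)
    moreover have "distinct (xs @ [w])" using p(2) split(1) by (auto simp: apath_def)
    moreover have "u \<notin> set xs" using p(3) split(1) by auto
    ultimately have "distinct (tl (pawalk_verts u c))"
      unfolding tl using split(3) q1v q'(3) by auto
    then have "cycle c" using cw by (auto simp: cycle_def c_def)
    then have "p1 = []" "rev_path q1 = []" using no_long_cycle[of c] by (auto simp: c_def)
    then have "a = w" "b = w" using p1(1) q1(2) by (auto simp: awalk_Nil_iff)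
    then show ?thesis using False by simp
  qed
qed

text \<open>A longest prolongation ends in a leaf \<open>l\<close>: a neighbour of \<open>l\<close>
  off the path would prolong it further, and a neighbour \<open>x\<close> on the path is the
  predecessor of \<open>l\<close>, since the stretch from \<open>x\<close> to \<open>l\<close> must
  equal the single arc by uniqueness. As \<open>p\<close> is nonempty, a predecessor exists.\<close>

lemma apath_extends_to_leaf:
  assumes "apath r p v" "p \<noteq> []"
  obtains q l where "apath r (p @ q) l" "l \<in> leaves G"
proof -
  let ?P = "\<lambda>q. \<exists>l. apath r (p @ q) l"
  have "?P []" using assms by auto
  \<comment> \<open>Simple paths have fewer arcs than there are vertices, so a longest prolongation
    exists.\<close>
  moreover have "\<forall>q. ?P q \<longrightarrow> length q < card (pverts G)"
    using length_apath_less by fastforce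
  ultimately have "\<exists>q. ?P q \<and> (\<forall>q'. ?P q' \<longrightarrow> length q' \<le> length q)"
    by (rule ex_has_greatest_nat)
  then obtain q where "?P q" and max: "\<And>q'. ?P q' \<Longrightarrow> length q' \<le> length q" by auto
  then obtain l where l: "apath r (p @ q) l" by blast
  define s where "s = p @ q"
  have s: "apath r s l" "s \<noteq> []" using l assms(2) by (auto simp: s_def)
  have sw: "awalk r s l" using s(1) by (simp add: apath_def)
  obtain s' e where s': "s = s' @ [e]" using s(2) by (cases s rule: rev_cases) auto
  obtain w where e: "e = (w, l)" using sw s' by (cases e) (auto simp: awalk_simps)
  have wl: "(w, l) \<in> parcs G" using sw s' e by (auto simp: awalk_simps)
  have "x = w" if x: "(l, x) \<in> parcs G" for x
  proof (cases "x \<in> set (pawalk_verts r s)")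
    case True
    then obtain s1 s2 where s12: "s = s1 @ s2" "awalk r s1 x" "awalk x s2 l"
      using awalk_decomp[OF sw] by blast
    have "apath x s2 l" using s(1) s12 by (auto simp: apath_append_iff)
    moreover have "apath x [(x, l)] l"
      using x no_loops' arcs_symmetric in_arcsD1 by (auto simp: apath_simps)
    ultimately have "s2 = [(x, l)]" by (rule apath_unique)
    then show ?thesis using s12(1) s' e by simp
  next
    case False
    have "awalk r (s @ [(l, x)]) x"
      by (rule awalk_appendI[OF sw]) (use x in_arcsD2 in \<open>auto simp: awalk_simps\<close>)
    then have "apath r (p @ q @ [(l, x)]) x"
      using awalk_verts_append[of r s "[(l, x)]" x] False s(1)
      by (auto simp: apath_def s_def)
    then show ?thesis using max[of "q @ [(l, x)]"] by auto
  qed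
  then have "parcs G \<inter> {l} \<times> UNIV = {(l, w)}" using arcs_symmetric[OF wl] by blast
  moreover have "out_arcs G l = parcs G \<inter> {l} \<times> UNIV" by (auto simp: out_arcs_def)
  ultimately have "l \<in> leaves G" using in_arcsD2[OF wl] by (simp add: leaves_def out_degree_def)
  with l that show thesis by blast
qed

text \<open>Two of the paths reaching the same leaf would, by uniqueness, be nested, so that one of the
  sets \<open>A i\<close> would contain the target of another.\<close>
lemma card_leaves_ge:
  assumes "\<And>i. i \<in> I \<Longrightarrow> \<exists>p. apath r p (x i) \<and> set (pawalk_verts r p) \<subseteq> A i"
    and "\<And>i. i \<in> I \<Longrightarrow> x i \<noteq> r"
    and "\<And>i j. i \<in> I \<Longrightarrow> j \<in> I \<Longrightarrow> i \<noteq> j \<Longrightarrow> x i \<notin> A j"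
  shows "card I \<le> card (leaves G)"
proof -
  obtain p where p: "\<And>i. i \<in> I \<Longrightarrow> apath r (p i) (x i)"
      "\<And>i. i \<in> I \<Longrightarrow> set (pawalk_verts r (p i)) \<subseteq> A i"
    using assms(1) by metis
  have "p i \<noteq> []" if "i \<in> I" for i
    using p(1)[OF that] assms(2)[OF that] by (auto simp: apath_Nil_iff)
  then have "\<exists>q l. apath r (p i @ q) l \<and> l \<in> leaves G" if "i \<in> I" for i
    using apath_extends_to_leaf p(1) that by metis
  then obtain q l where ql: "\<And>i. i \<in> I \<Longrightarrow> apath r (p i @ q i) (l i)"
      "\<And>i. i \<in> I \<Longrightarrow> l i \<in> leaves G"
    by metis
  have *: "i = j" if ij: "i \<in> I" "j \<in> I" "p j = p i @ us" for i j us
  proof (rule ccontr)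
    assume "i \<noteq> j"
    have "awalk r (p i) (x i)" "awalk r (p i @ us) (x j)"
      using p(1)[OF ij(1)] p(1)[OF ij(2)] ij(3) by (simp_all only: apath_def)
    then have "x i \<in> set (pawalk_verts r (p j))"
      unfolding ij(3) awalk_verts_append[OF \<open>awalk r (p i @ us) (x j)\<close>]
      by (simp add: last_in_awalk_verts)
    then show False using p(2) assms(3) ij \<open>i \<noteq> j\<close> by blast
  qed
  have "inj_on l I"
  proof (rule inj_onI)
    fix i j assume ij: "i \<in> I" "j \<in> I" "l i = l j"
    have "p i @ q i = p j @ q j" using ql(1) ij by (metis apath_unique)
    then show "i = j" using * ij unfolding append_eq_append_conv2 by metis
  qed
  then show ?thesis
    using ql(2) by (intro card_inj_on_le) (auto simp: leaves_def pair_finite_verts)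
qed

text \<open>A path from \<open>a\<close> to another vertex prolongs to a leaf other than
  \<open>a\<close>. Doing this twice, the second time starting from the leaf just found, yields two
  leaves.\<close>

lemma card_leaves_ge_2:
  assumes "Digraph_Component.connected G" "x \<in> pverts G" "y \<in> pverts G" "x \<noteq> y"
  shows "2 \<le> card (leaves G)"
proof -
  have sc: "strongly_connected G"
    using assms(1) pair_sym_arcs by (rule symmetric_connected_imp_strongly_connected[rotated])
  have leaf: "\<exists>l. l \<in> leaves G \<and> l \<noteq> a" if ab: "a \<in> pverts G" "b \<in> pverts G" "a \<noteq> b" for a b
  proof -
    have "a \<rightarrow>\<^sup>*\<^bsub>with_proj G\<^esub> b" using sc ab by (auto simp: strongly_connected_def)
    then obtain p where p: "apath a p b" by (auto simp: reachable_apath)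
    then have "p \<noteq> []" using ab by (auto simp: apath_Nil_iff)
    then obtain q l where "apath a (p @ q) l" "l \<in> leaves G"
      using apath_extends_to_leaf p by blast
    then show ?thesis using apath_nonempty_ends \<open>p \<noteq> []\<close> by blast
  qed
  obtain l where l: "l \<in> leaves G" using leaf assms by blast
  then have "l \<in> pverts G" by (simp add: leaves_def)
  then obtain l' where l': "l' \<in> leaves G" "l' \<noteq> l" using leaf assms by metis
  have "finite (leaves G)" by (auto simp: leaves_def pair_finite_verts)
  then have "card {l, l'} \<le> card (leaves G)" using l l' by (intro card_mono) auto
  then show ?thesis using l' by simp
qed

end

lemma undirected_tree_iff:
  "undirected_tree H \<longleftrightarrow> pair_acyclic_graph H \<and> Digraph_Component.connected (with_proj H)"
  unfolding undirected_tree_def pair_acyclic_graph_def pair_acyclic_graph_axioms_def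
  using not_le by blast

text \<open>The path is chosen inside \<open>S\<close> and stays a path in the host. This provides
  the confined paths that \<open>card_leaves_ge\<close> asks for.\<close>

lemma subtree_apath:
  assumes "subtree S H" "u \<in> pverts S" "v \<in> pverts S"
  shows "\<exists>p. pre_digraph.apath H u p v \<and> set (pawalk_verts u p) \<subseteq> pverts S"
proof -
  interpret S: pair_graph S using assms by (simp add: subtree_def)
  have "strongly_connected S"
    using assms(1) S.pair_sym_arcs S.symmetric_connected_imp_strongly_connected
    by (auto simp: subtree_def)
  then have "u \<rightarrow>\<^sup>*\<^bsub>with_proj S\<^esub> v" using assms by (auto simp: strongly_connected_def)
  then obtain p where p: "S.apath u p v" by (auto simp: S.reachable_apath)
  have sub: "subgraph S H" using assms by (simp add: subtree_def)
  then interpret H: wf_digraph "with_proj H" by (simp add: subgraph_def)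
  have "H.apath u p v" using H.subgraph_apath_imp_apath[OF p sub] .
  moreover have "set (pawalk_verts u p) \<subseteq> pverts S"
    using p by (auto simp: S.apath_def)
  ultimately show ?thesis by blast
qed

section \<open>Trees given by a parent function\<close>

text \<open>One encoding for all trees built below: a path (\<open>f i = i - 1\<close>), a star
  (\<open>f i = 0\<close>) and single vertices (\<open>V = {r}\<close>). The value of
  \<open>f\<close> at the root is ignored.\<close>

definition parent_graph :: "(nat \<Rightarrow> nat) \<Rightarrow> nat \<Rightarrow> nat set \<Rightarrow> nat pair_pre_digraph" where
  "parent_graph f r V =
     \<lparr> pverts = V, parcs = (\<Union>i\<in>V - {r}. {(i, f i), (f i, i)}) \<rparr>"

text \<open>Since parents are smaller numbers, climbing from any vertex ends at the root, which
  gives connectedness; the same order excludes long cycles.\<close>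

locale parent_tree =
  fixes f :: "nat \<Rightarrow> nat" and r :: nat and V :: "nat set"
  assumes finite_V: "finite V" and root: "r \<in> V"
    and parent_less: "i \<in> V \<Longrightarrow> i \<noteq> r \<Longrightarrow> f i < i"
    and parent_in: "i \<in> V \<Longrightarrow> i \<noteq> r \<Longrightarrow> f i \<in> V"
begin

abbreviation G where "G \<equiv> parent_graph f r V"

sublocale pair_graph G
proof
  show "finite (pverts G)" using finite_V by (simp add: parent_graph_def)
  show "finite (parcs G)" using finite_V by (auto simp: parent_graph_def)
  show "symmetric (with_proj G)" by (auto simp: symmetric_def sym_def parent_graph_def)
qed (use parent_in parent_less in \<open>fastforce simp: parent_graph_def\<close>)+

lemma connected: "Digraph_Component.connected G"
proof -
  have down: "i \<rightarrow>\<^sup>*\<^bsub>with_proj G\<^esub> r" if "i \<in> V" for i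
    using that
  proof (induction i rule: less_induct)
    case (less i)
    show ?case
    proof (cases "i = r")
      case True
      then show ?thesis using less.prems reachable_refl[of r] by (simp add: parent_graph_def)
    next
      case False
      then have "(i, f i) \<in> parcs G" using less.prems by (auto simp: parent_graph_def)
      moreover have "f i \<rightarrow>\<^sup>*\<^bsub>with_proj G\<^esub> r"
        using less False parent_less parent_in by blast
      ultimately show ?thesis using adj_reachable_trans by blast
    qed
  qed
  have "r \<rightarrow>\<^sup>*\<^bsub>with_proj G\<^esub> i" if "i \<in> V" for i
    using symmetric_reachable[OF pair_sym_arcs down[OF that]] .
  then have "strongly_connected G"
    using root reachable_trans[OF down]
    by (intro strongly_connectedI) (auto simp: parent_graph_def)
  \<comment> \<open>Connectedness is strong connectedness of the symmetric closure, which adds no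
    arcs here.\<close>
  moreover have "mk_symmetric G = G"
    unfolding mk_symmetric_def by (auto simp: parent_graph_def)
  ultimately show ?thesis by (simp only: Digraph_Component.connected_def)
qed

text \<open>On a cycle, both neighbours of the largest vertex are its parent.\<close>
sublocale pair_acyclic_graph G
proof
  fix c assume "cycle c"
  then obtain u where c: "awalk u c u" "distinct (tl (pawalk_verts u c))" "c \<noteq> []"
    by (auto simp: cycle_def)
  define m where "m = Max (set (pawalk_verts u c))"
  have m: "m \<in> set (pawalk_verts u c)"
    unfolding m_def by (rule Max_in) (use c in \<open>cases c; auto\<close>)+
  obtain q s where qs: "c = q @ s" "awalk u q m" "awalk m s u"
    using awalk_decomp[OF c(1) m] by blast
  \<comment> \<open>The cycle rotated so that it starts and ends at its largest vertex
    \<open>m\<close>.\<close>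
  define d where "d = s @ q"
  have d: "awalk m d m" unfolding d_def using qs by (auto intro: awalk_appendI)
  have vd: "pawalk_verts m d = pawalk_verts m s @ tl (pawalk_verts u q)"
    using d qs(3) awalk_verts_append[of m s q m] by (simp add: d_def)
  have vc: "pawalk_verts u c = pawalk_verts u q @ tl (pawalk_verts m s)"
    using c(1) qs awalk_verts_append[of u q s u] by simp
  have dd: "distinct (tl (pawalk_verts m d))"
    using c(2) unfolding vd vc by (cases q; cases s) auto
  have le: "x \<le> m" if "x \<in> set (pawalk_verts m d)" for x
  proof -
    have "set (pawalk_verts m d) \<subseteq> set (pawalk_verts u c)"
      unfolding vd vc using last_in_awalk_verts[OF qs(2)] qs(3)
      by (cases q; cases s) (auto simp: awalk_Cons_iff)
    then show ?thesis using that unfolding m_def by (auto intro: Max_ge)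
  qed
  \<comment> \<open>The other kind of arc leads from \<open>m\<close> to a child, which is larger
    than \<open>m\<close>.\<close>
  have parent: "x = f m" if "(m, x) \<in> parcs G" "x \<le> m" for x
    using that by (fastforce simp: parent_graph_def dest: parent_less)
  show "length c < 3"
  proof (rule ccontr)
    assume "\<not> length c < 3"
    then have "length d \<ge> 3" using qs(1) by (simp add: d_def)
    then obtain e d' where ed: "d = e # d'" "length d' \<ge> 2" by (cases d) auto
    then obtain g h where "d' = g @ [h]" by (cases d' rule: rev_cases) auto
    with ed have deq: "d = e # g @ [h]" "g \<noteq> []" by auto
    obtain a where e: "e = (m, a)" using d deq by (cases e) (auto simp: awalk_simps)
    obtain b where h: "h = (b, m)" using d deq by (cases h) (auto simp: awalk_simps)
    have w: "(m, a) \<in> parcs G" "awalk a (g @ [(b, m)]) m"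
      using d deq e h by (auto simp: awalk_Cons_iff)
    then have g: "awalk a g b" "(b, m) \<in> parcs G" by (auto simp: awalk_simps)
    have v: "pawalk_verts m d = m # pawalk_verts a g @ [m]"
      using awalk_verts_append[OF w(2)] g(1) deq e h by simp
    have "a \<in> set (pawalk_verts a g)" "b \<in> set (pawalk_verts a g)"
      using g(1) hd_in_awalk_verts(1) last_in_awalk_verts by blast+
    then have "a \<le> m" "b \<le> m" using le v by auto
    \<comment> \<open>The cycle leaves \<open>m\<close> towards \<open>f m\<close> and comes back
      from \<open>f m\<close>, so the nonempty simple path \<open>g\<close> in between would be
      closed.\<close>
    then have "a = b" using parent w(1) arcs_symmetric[OF g(2)] by metis
    moreover have "apath a g b" using g(1) dd v by (auto simp: apath_def)
    ultimately show False using apath_nonempty_ends deq(2) by blast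
  qed
qed

lemma undirected_tree: "undirected_tree G"
  using connected pair_acyclic_graph_axioms by (simp add: undirected_tree_iff)

text \<open>Each edge of the smaller tree joins some vertex of \<open>W - {s}\<close> to its parent.
  The parent function is shared and these vertices are not the root \<open>r\<close>, so the edge
  also belongs to \<open>G\<close>.\<close>

lemma subtree:
  assumes "parent_tree f s W" "W - {s} \<subseteq> V - {r}" "s \<in> V"
  shows "subtree (parent_graph f s W) G"
proof -
  interpret W: parent_tree f s W by fact
  have "subgraph W.G G"
    unfolding subgraph_def using assms wf_digraph W.wf_digraph
    by (auto simp: parent_graph_def compatible_def)
  then show ?thesis
    unfolding subtree_def using W.connected W.pair_graph by blast
qed

lemma leavesD:
  assumes "v \<in> leaves G" "(v, a) \<in> parcs G" "(v, b) \<in> parcs G"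
  shows "a = b"
proof -
  have "card (out_arcs G v) = 1" using assms(1) by (simp add: leaves_def out_degree_def)
  then obtain e where "out_arcs G v = {e}" by (auto simp: card_1_singleton_iff)
  moreover have "(v, a) \<in> out_arcs G v" "(v, b) \<in> out_arcs G v"
    using assms by (auto simp: out_arcs_def)
  ultimately show ?thesis by auto
qed

end

lemma pverts_parent_graph [simp]: "pverts (parent_graph f r V) = V"
  by (simp add: parent_graph_def)

lemma parent_tree_singleton: "parent_tree f r {r}"
  by unfold_locales auto

section \<open>The digraphs \<open>F\<^sub>n\<close>\<close>

lemma parcs_F_digraph:
  assumes "n \<ge> 1"
  shows "(u, v) \<in> parcs (F_digraph n) \<longleftrightarrow>
    u < n \<and> v < n \<and> (u = v \<or> u = n - 1 \<or> v = n - 1)"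
  using assms by (cases "u < n - 1"; cases "v < n - 1")
    (auto simp: F_digraph_def F_matrix_def Let_def)

lemma pverts_F_digraph [simp]: "pverts (F_digraph n) = {..<n}"
  by (simp add: F_digraph_def)

section \<open>Lower bounds on the number of leaves\<close>

lemma two_le_card_leaves:
  assumes "subtree_rep D H S T" "u \<in> pverts D" "v \<in> pverts D" "(u, v) \<notin> parcs D"
  shows "2 \<le> card (leaves H)"
proof -
  have H: "pair_acyclic_graph H" "Digraph_Component.connected H"
    and sub: "subtree (S u) H" "subtree (T v) H"
    and disj: "pverts (S u) \<inter> pverts (T v) = {}"
    using assms by (auto simp: subtree_rep_def undirected_tree_iff)
  have "pverts (S u) \<noteq> {}" "pverts (T v) \<noteq> {}"
    using sub by (auto simp: subtree_def connected_conv)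
  \<comment> \<open>A missing edge means disjoint subtrees, so the host has two different
    vertices.\<close>
  then obtain x y where "x \<in> pverts (S u)" "y \<in> pverts (T v)" by blast
  moreover have "pverts (S u) \<subseteq> pverts H" "pverts (T v) \<subseteq> pverts H"
    using sub by (auto simp: subtree_def subgraph_def)
  ultimately show ?thesis
    using pair_acyclic_graph.card_leaves_ge_2[OF H, of x y] disj by blast
qed

lemma catch_card_leaves_ge:
  assumes "n \<ge> 3" "catch_tree_rep (F_digraph n) H S T"
  shows "n - 1 \<le> card (leaves H)"
proof -
  have rep: "subtree_rep (F_digraph n) H S T"
    and "\<forall>v<n. \<exists>x. pverts (T v) = {x}"
    using assms(2) by (auto simp: catch_tree_rep_def)
  then obtain x where x: "\<And>v. v < n \<Longrightarrow> pverts (T v) = {x v}" by metis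
  have mem: "x v \<in> pverts (S u) \<longleftrightarrow> u = v \<or> u = n - 1 \<or> v = n - 1" if "u < n" "v < n" for u v
    using rep that x[OF that(2)] parcs_F_digraph[of n u v] assms(1)
    by (auto simp: subtree_rep_def)
  interpret pair_acyclic_graph H
    using rep by (simp add: subtree_rep_def undirected_tree_iff)
  have "card {..<n - 1} \<le> card (leaves H)"
  proof (rule card_leaves_ge[of _ "x (n - 1)" x "\<lambda>i. pverts (S i)"])
    fix i assume i: "i \<in> {..<n - 1}"
    have "subtree (S i) H" using rep i by (auto simp: subtree_rep_def)
    then show "\<exists>p. apath (x (n - 1)) p (x i) \<and>
        set (pawalk_verts (x (n - 1)) p) \<subseteq> pverts (S i)"
      by (rule subtree_apath) (use i mem in auto)
    \<comment> \<open>Some index below \<open>n - 1\<close> other than \<open>i\<close>, available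
      as \<open>n \<ge> 3\<close>. Its source subtree contains the sink vertex of
      \<open>n - 1\<close> but not \<open>x i\<close>, which separates the two.\<close>
    define j :: nat where "j = (if i = 0 then 1 else 0)"
    have j: "j \<noteq> i" "j < n - 1" using assms(1) by (auto simp: j_def)
    then have "x i \<notin> pverts (S j)" "x (n - 1) \<in> pverts (S j)" using mem[of j] i by auto
    then show "x i \<noteq> x (n - 1)" by metis
  next
    fix i j assume "i \<in> {..<n - 1}" "j \<in> {..<n - 1}" "i \<noteq> j"
    then show "x i \<notin> pverts (S j)" using mem[of j i] by auto
  qed
  then show ?thesis by simp
qed

section \<open>Representations attaining the bounds\<close>

lemma exists_path_rep:
  assumes "n \<ge> 3"
  shows "\<exists>(H :: nat pair_pre_digraph) S T.
    subtree_rep (F_digraph n) H S T \<and> card (leaves H) \<le> 2"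
proof -
  let ?f = "\<lambda>i::nat. i - 1"
  let ?H = "parent_graph ?f 0 {..<n - 1}"
  interpret H: parent_tree ?f 0 "{..<n - 1}"
    using assms by unfold_locales auto
  \<comment> \<open>Used for sources and sinks alike: distinct single vertices are disjoint, giving
    the identity block, and the whole path meets everything.\<close>
  define S where "S v = (if v = n - 1 then ?H else parent_graph ?f v {v})" for v
  have S: "subtree (S v) ?H" if "v < n" for v
    using that assms H.subtree[OF H.parent_tree_axioms]
      H.subtree[OF parent_tree_singleton, of v]
    by (auto simp: S_def)
  have "subtree_rep (F_digraph n) ?H S S"
    unfolding subtree_rep_def using H.undirected_tree S assms
    by (auto simp: parcs_F_digraph S_def lessThan_empty_iff)
  \<comment> \<open>A vertex strictly between the ends \<open>0\<close> and \<open>n - 2\<close> has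
    a neighbour on each side. An inclusion suffices, as the lower bound comes from
    elsewhere.\<close>
  moreover have "leaves ?H \<subseteq> {0, n - 2}"
  proof
    fix v assume v: "v \<in> leaves ?H"
    then have "v < n - 1" by (simp add: leaves_def)
    show "v \<in> {0, n - 2}"
    proof (rule ccontr)
      assume "v \<notin> {0, n - 2}"
      then have "(v, v - 1) \<in> parcs ?H" "(v, Suc v) \<in> parcs ?H"
        using \<open>v < n - 1\<close> by (auto simp: parent_graph_def intro: bexI[of _ "Suc v"])
      then show False using H.leavesD[OF v] by fastforce
    qed
  qed
  then have "card (leaves ?H) \<le> card {0, n - 2}" by (intro card_mono) auto
  then have "card (leaves ?H) \<le> 2" using card_insert_le_m1[of 2 "{n - 2}" 0] by simp
  ultimately show ?thesis by blast
qed

lemma exists_star_catch_rep: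
  assumes "n \<ge> 3"
  shows "\<exists>(H :: nat pair_pre_digraph) S T.
    catch_tree_rep (F_digraph n) H S T \<and> card (leaves H) \<le> n - 1"
proof -
  let ?f = "\<lambda>i::nat. 0::nat"
  let ?H = "parent_graph ?f 0 {..<n}"
  interpret H: parent_tree ?f 0 "{..<n}"
    using assms by unfold_locales auto
  \<comment> \<open>The centre of the star is \<open>0\<close>, so vertex \<open>v < n - 1\<close>
    of the digraph is shifted to \<open>Suc v\<close>. Its source is the edge from there to the
    centre, where the sink of the last vertex sits.\<close>
  define S where "S v = (if v = n - 1 then ?H else parent_graph ?f 0 {0, Suc v})" for v
  define T where "T v = (let t = (if v = n - 1 then 0 else Suc v) in parent_graph ?f t {t})" for v
  have edge: "parent_tree ?f 0 {0, Suc v}" for v by unfold_locales auto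
  have S: "subtree (S v) ?H" if "v < n" for v
    using that H.subtree[OF H.parent_tree_axioms] assms
    by (auto simp: S_def intro!: H.subtree edge)
  have T: "subtree (T v) ?H" if "v < n" for v
    using that assms by (auto simp: T_def Let_def intro!: H.subtree parent_tree_singleton)
  have "catch_tree_rep (F_digraph n) ?H S T"
    unfolding catch_tree_rep_def subtree_rep_def using H.undirected_tree S T assms
    by (auto simp: parcs_F_digraph S_def T_def Let_def)
  moreover have "leaves ?H \<subseteq> {1..<n}"
  proof
    fix v assume v: "v \<in> leaves ?H"
    \<comment> \<open>With \<open>n \<ge> 3\<close> the centre has two neighbours and is no
      leaf.\<close>
    have "(0, 1) \<in> parcs ?H" "(0, 2) \<in> parcs ?H" using assms by (auto simp: parent_graph_def)
    then have "v \<noteq> 0" using H.leavesD[of 0 1 2] v by (metis numeral_eq_one_iff num.distinct(1))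
    then show "v \<in> {1..<n}" using v by (simp add: leaves_def)
  qed
  then have "card (leaves ?H) \<le> card {1..<n}" by (intro card_mono) auto
  then have "card (leaves ?H) \<le> n - 1" by simp
  ultimately show ?thesis by blast
qed

section \<open>The values of the three parameters\<close>

lemma leafage_F_digraph:
  assumes "n \<ge> 3"
  shows "leafage (F_digraph n) = 2"
  unfolding leafage_def
proof (rule Least_equality)
  \<comment> \<open>Both \<open>0\<close> and \<open>1\<close> differ from \<open>n - 1\<close>, so
    \<open>(0, 1)\<close> is a missing edge.\<close>
  have ge: "2 \<le> card (leaves H)" if "subtree_rep (F_digraph n) H S T"
    for H :: "nat pair_pre_digraph" and S T
    by (rule two_le_card_leaves[OF that, of 0 1]) (use assms in \<open>auto simp: parcs_F_digraph\<close>)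
  show "\<exists>(H :: nat pair_pre_digraph) S T. subtree_rep (F_digraph n) H S T \<and> card (leaves H) = 2"
    using exists_path_rep[OF assms] ge by (meson le_antisym)
  show "2 \<le> k" if "\<exists>(H :: nat pair_pre_digraph) S T.
      subtree_rep (F_digraph n) H S T \<and> card (leaves H) = k" for k
    using that ge by blast
qed

lemma catch_leafage_F_digraph:
  assumes "n \<ge> 3"
  shows "catch_leafage (F_digraph n) = n - 1"
  unfolding catch_leafage_def
proof (rule Least_equality)
  note ge = catch_card_leaves_ge[OF assms]
  show "\<exists>(H :: nat pair_pre_digraph) S T.
      catch_tree_rep (F_digraph n) H S T \<and> card (leaves H) = n - 1"
    using exists_star_catch_rep[OF assms] ge by (meson le_antisym)
  show "n - 1 \<le> k" if "\<exists>(H :: nat pair_pre_digraph) S T.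
      catch_tree_rep (F_digraph n) H S T \<and> card (leaves H) = k" for k
    using that ge by blast
qed

text \<open>The complement is the off-diagonal part of the leading block, which splits into the
  parts above and below the diagonal. One Ferrers digraph cannot contain both \<open>(0, 1)\<close>
  and \<open>(1, 0)\<close>: comparing the successor sets of \<open>0\<close> and \<open>1\<close>
  would put \<open>(0, 0)\<close> or \<open>(1, 1)\<close> into it.\<close>

lemma ferrers_partition_number_F_digraph:
  assumes "n \<ge> 3"
  shows "ferrers_partition_number (F_digraph n) = 2"
  unfolding ferrers_partition_number_def
proof (rule Least_equality)
  let ?F = "F_digraph n"
  have compl: "(u, v) \<in> parcs (complement_digraph ?F) \<longleftrightarrow> u < n - 1 \<and> v < n - 1 \<and> u \<noteq> v" for u v
    using assms by (auto simp: complement_digraph_def parcs_F_digraph)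
  \<comment> \<open>Successor sets in \<open>U\<close> shrink as the vertex grows; in
    \<open>L\<close> they are initial segments, or empty for the last vertex. Both families are
    nested.\<close>
  define U where "U = {(u, v). u < v \<and> v < n - 1}"
  define L where "L = {(u, v). v < u \<and> u < n - 1}"
  have fin: "pair_fin_digraph \<lparr> pverts = {..<n}, parcs = E \<rparr>" if "E \<subseteq> {..<n} \<times> {..<n}" for E
    using that finite_subset[OF that] by unfold_locales auto
  have "ferrers_digraph \<lparr> pverts = {..<n}, parcs = U \<rparr>"
  proof -
    have "pair_fin_digraph \<lparr> pverts = {..<n}, parcs = U \<rparr>" by (rule fin) (auto simp: U_def)
    then show ?thesis using nle_le by (fastforce simp: ferrers_digraph_def U_def)
  qed
  moreover have "ferrers_digraph \<lparr> pverts = {..<n}, parcs = L \<rparr>"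
  proof -
    have "pair_fin_digraph \<lparr> pverts = {..<n}, parcs = L \<rparr>" by (rule fin) (auto simp: L_def)
    then show ?thesis using nle_le by (fastforce simp: ferrers_digraph_def L_def)
  qed
  moreover have "(0, 1) \<in> U" "(0, 1) \<notin> L" using assms by (auto simp: U_def L_def)
  then have "U \<noteq> L" by metis
  then have "card {U, L} = 2" by simp
  moreover have "disjoint {U, L}" by (auto simp: disjoint_def U_def L_def)
  moreover have "\<Union>{U, L} = parcs (complement_digraph ?F)"
    using compl by (auto simp: U_def L_def)
  ultimately show "\<exists>\<F>. finite \<F> \<and> card \<F> = 2 \<and>
     (\<forall>E\<in>\<F>. ferrers_digraph \<lparr> pverts = pverts ?F, parcs = E \<rparr>) \<and>
     disjoint \<F> \<and> \<Union>\<F> = parcs (complement_digraph ?F)"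
    by (intro exI[of _ "{U, L}"]) auto
  fix k assume "\<exists>\<F>. finite \<F> \<and> card \<F> = k \<and>
     (\<forall>E\<in>\<F>. ferrers_digraph \<lparr> pverts = pverts ?F, parcs = E \<rparr>) \<and>
     disjoint \<F> \<and> \<Union>\<F> = parcs (complement_digraph ?F)"
  then obtain \<F> where \<F>: "finite \<F>" "card \<F> = k"
     "\<And>E. E \<in> \<F> \<Longrightarrow> ferrers_digraph \<lparr> pverts = {..<n}, parcs = E \<rparr>"
     "\<Union>\<F> = parcs (complement_digraph ?F)" by auto
  have "(0, 1) \<in> \<Union>\<F>" "(1, 0) \<in> \<Union>\<F>" using assms by (auto simp: \<F>(4) compl)
  then obtain A B where AB: "A \<in> \<F>" "B \<in> \<F>" "(0, 1) \<in> A" "(1, 0) \<in> B" by blast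
  have "A \<noteq> B"
  proof
    assume "A = B"
    moreover have "A `` {0} \<subseteq> A `` {1} \<or> A `` {1} \<subseteq> A `` {0}"
      using \<F>(3)[OF AB(1)] assms by (auto simp: ferrers_digraph_def)
    ultimately have "(0, 0) \<in> A \<or> (1, 1) \<in> A" using AB by auto
    then have "(0, 0) \<in> \<Union>\<F> \<or> (1, 1) \<in> \<Union>\<F>" using AB(1) by blast
    then show False by (simp add: \<F>(4) compl)
  qed
  then have "card {A, B} = 2" by simp
  then show "2 \<le> k" using card_mono[OF \<F>(1), of "{A, B}"] AB \<F>(2) by simp
qed

theorem theorem10:
  shows "\<not> (\<exists>g :: nat \<Rightarrow> nat. \<forall>D :: nat pair_pre_digraph.
             pair_fin_digraph D \<longrightarrow> catch_leafage D \<le> g (leafage D)) \<and>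
         (\<forall>n \<ge> 3. ferrers_partition_number (F_digraph n) = 2 \<and>
                  leafage (F_digraph n) = 2 \<and>
                  catch_leafage (F_digraph n) = n - 1)"
proof (intro conjI notI)
  assume "\<exists>g :: nat \<Rightarrow> nat. \<forall>D :: nat pair_pre_digraph.
             pair_fin_digraph D \<longrightarrow> catch_leafage D \<le> g (leafage D)"
  then obtain g :: "nat \<Rightarrow> nat" where
    g: "\<And>D :: nat pair_pre_digraph. pair_fin_digraph D \<Longrightarrow> catch_leafage D \<le> g (leafage D)"
    by blast
  \<comment> \<open>For \<open>n = g 2 + 3\<close> the leafage is 2, while the catch leafage
    \<open>g 2 + 2\<close> exceeds \<open>g 2\<close>.\<close>
  show False
    using g[OF pair_fin_digraph_F[of "g 2 + 3"]]
    by (simp add: leafage_F_digraph catch_leafage_F_digraph)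
qed (simp add: ferrers_partition_number_F_digraph leafage_F_digraph catch_leafage_F_digraph)

end
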